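(* Let $G$ be a group not isomorphic to $\mathbb{Z}_2$ (the group of order $2$) which admits a Cayley representation, and let $\psi:\mathbb{Z}\to \mathrm{Aut}(G)$ be a group homomorphism. Then the semidirect product $G\rtimes_\psi \mathbb{Z}$ admits a regular poset representation.
   Context: For a group $G$ and a non-empty subset $S\subseteq G$, the Cayley poset $P(G,S)$ has as underlying set the disjoint union of two copies $G$ and $G'=\{g' : g\in G\}$ of $G$; for $g,h\in G$ one sets $g<h'$ if and only if $h\in gS$, and no other pair of different points is comparable. Left multiplication on each copy of $G$ gives an action $L:G\to \mathrm{Aut}(P(G,S))$, where for a poset $\mathrm{Aut}$ denotes the group of poset automorphisms. If every automorphism of $P(G,S)$ is in the image of $L$, then $P(G,S)$ is called a Cayley representation of $G$. The group $G$ admits a Cayley representation if there is a non-empty $S\subseteq G$ such that $P(G,S)$ is a Cayley representation of $G$. Groups are not assumed to be finite. A poset representation of a group $H$ is a poset $P$ together with a group isomorphism $H\to \mathrm{Aut}(P)$. It is regular if the induced action of $H$ on the underlying set of $P$ is free (all point stabilizers are trivial) and has exactly one orbit. *)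

theory Defs
  imports "HOL-Algebra.Group_Action" "HOL-Algebra.Elementary_Groups"
begin

text \<open>A poset is a carrier set \<open>A\<close> together with a relation \<open>r\<close> (meaning \<open>\<le>\<close>) such that
  \<^term>\<open>partial_order_on A r\<close>. As in \<^const>\<open>AutoGroup\<close>, automorphisms are taken to be
  extensional functions, so that each automorphism is represented by exactly one element.\<close>

definition poset_Aut :: "'a set \<Rightarrow> 'a rel \<Rightarrow> ('a \<Rightarrow> 'a) monoid" where
  "poset_Aut A r = BijGroup A
     \<lparr>carrier := {f \<in> Bij A. \<forall>x\<in>A. \<forall>y\<in>A. (f x, f y) \<in> r \<longleftrightarrow> (x, y) \<in> r}\<rparr>"

definition cayley_points :: "('a, 'b) monoid_scheme \<Rightarrow> ('a + 'a) set" where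
  "cayley_points G = carrier G <+> carrier G"

definition cayley_le :: "('a, 'b) monoid_scheme \<Rightarrow> 'a set \<Rightarrow> ('a + 'a) rel" where
  "cayley_le G S = Id_on (cayley_points G)
     \<union> {(Inl g, Inr h) | g h. g \<in> carrier G \<and> h \<in> carrier G \<and> h \<in> g <#\<^bsub>G\<^esub> S}"

definition cayley_translation :: "('a, 'b) monoid_scheme \<Rightarrow> 'a \<Rightarrow> 'a + 'a \<Rightarrow> 'a + 'a" where
  "cayley_translation G g =
     restrict (map_sum (\<lambda>x. g \<otimes>\<^bsub>G\<^esub> x) (\<lambda>x. g \<otimes>\<^bsub>G\<^esub> x)) (cayley_points G)"

definition is_cayley_representation :: "('a, 'b) monoid_scheme \<Rightarrow> 'a set \<Rightarrow> bool" where
  "is_cayley_representation G S \<longleftrightarrow> S \<subseteq> carrier G \<and> S \<noteq> {} \<and>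
     carrier (poset_Aut (cayley_points G) (cayley_le G S)) \<subseteq> cayley_translation G ` carrier G"

definition admits_cayley_representation :: "('a, 'b) monoid_scheme \<Rightarrow> bool" where
  "admits_cayley_representation G \<longleftrightarrow> (\<exists>S. is_cayley_representation G S)"

definition poset_representation ::
    "('h, 'b) monoid_scheme \<Rightarrow> 'p set \<Rightarrow> 'p rel \<Rightarrow> ('h \<Rightarrow> 'p \<Rightarrow> 'p) \<Rightarrow> bool" where
  "poset_representation H A r \<phi> \<longleftrightarrow> partial_order_on A r \<and> \<phi> \<in> iso H (poset_Aut A r)"

definition regular_poset_representation ::
    "('h, 'b) monoid_scheme \<Rightarrow> 'p set \<Rightarrow> 'p rel \<Rightarrow> ('h \<Rightarrow> 'p \<Rightarrow> 'p) \<Rightarrow> bool" where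
  "regular_poset_representation H A r \<phi> \<longleftrightarrow> poset_representation H A r \<phi> \<and>
     (\<forall>x\<in>A. stabilizer H \<phi> x = {\<one>\<^bsub>H\<^esub>}) \<and> (\<exists>!U. U \<in> orbits H A \<phi>)"

text \<open>HOL does not allow quantification over the type of the poset inside a definition. The
  poset is therefore sought on the element type of \<open>H\<close>; the lemma
  \<open>regular_poset_representation_imp_admits\<close> below shows that nothing is lost.\<close>

definition admits_regular_poset_representation :: "('h, 'b) monoid_scheme \<Rightarrow> bool" where
  "admits_regular_poset_representation H \<longleftrightarrow>
     (\<exists>(A :: 'h set) r \<phi>. regular_poset_representation H A r \<phi>)"

definition semidirect_product ::
    "('a, 'c) monoid_scheme \<Rightarrow> ('b, 'd) monoid_scheme \<Rightarrow> ('b \<Rightarrow> 'a \<Rightarrow> 'a) \<Rightarrow> ('a \<times> 'b) monoid" where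
  "semidirect_product G H \<psi> =
     \<lparr>carrier = carrier G \<times> carrier H,
      mult = (\<lambda>(g, h) (g', h'). (g \<otimes>\<^bsub>G\<^esub> \<psi> h g', h \<otimes>\<^bsub>H\<^esub> h')),
      one = (\<one>\<^bsub>G\<^esub>, \<one>\<^bsub>H\<^esub>)\<rparr>"

lemma carrier_poset_Aut:
  "carrier (poset_Aut A r) =
     {f \<in> Bij A. \<forall>x\<in>A. \<forall>y\<in>A. (f x, f y) \<in> r \<longleftrightarrow> (x, y) \<in> r}"
  by (simp add: poset_Aut_def)

lemma mult_poset_Aut:
  "f \<in> carrier (poset_Aut A r) \<Longrightarrow> g \<in> carrier (poset_Aut A r) \<Longrightarrow>
     f \<otimes>\<^bsub>poset_Aut A r\<^esub> g = compose A f g"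
  by (simp add: poset_Aut_def BijGroup_def)

lemma partial_order_on_cayley_le: "partial_order_on (cayley_points G) (cayley_le G S)"
  by (auto simp: partial_order_on_def preorder_on_def refl_on_def trans_def antisym_def
      cayley_le_def cayley_points_def)

lemma (in group) cayley_translation_in_Aut:
  assumes "S \<subseteq> carrier G" "g \<in> carrier G"
  shows "cayley_translation G g \<in> carrier (poset_Aut (cayley_points G) (cayley_le G S))"
proof -
  let ?t = "cayley_translation G g"
  have inj: "inj_on ?t (cayley_points G)"
    using assms by (auto simp: inj_on_def cayley_points_def cayley_translation_def)
  have surj: "?t ` cayley_points G = cayley_points G"
  proof
    show "?t ` cayley_points G \<subseteq> cayley_points G"
      using assms by (auto simp: cayley_points_def cayley_translation_def)
    show "cayley_points G \<subseteq> ?t ` cayley_points G"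
    proof
      fix y assume y: "y \<in> cayley_points G"
      let ?x = "map_sum (\<lambda>x. inv g \<otimes> x) (\<lambda>x. inv g \<otimes> x) y"
      have "?x \<in> cayley_points G" "?t ?x = y"
        using assms y by (auto simp: cayley_points_def cayley_translation_def m_assoc[symmetric])
      then show "y \<in> ?t ` cayley_points G" by (metis imageI)
    qed
  qed
  have coset: "g \<otimes> b \<in> (g \<otimes> a) <# S \<longleftrightarrow> b \<in> a <# S"
    if "a \<in> carrier G" "b \<in> carrier G" for a b
    using assms that by (auto simp: l_coset_def m_assoc subset_iff)
  show ?thesis
    using inj surj assms coset
    by (auto simp: carrier_poset_Aut Bij_def bij_betw_def cayley_le_def cayley_points_def
        cayley_translation_def)
qed

lemma regular_poset_representation_imp_admits:
  assumes "group H" and rep: "regular_poset_representation H A r \<phi>"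
  shows "admits_regular_poset_representation H"
proof -
  interpret group H by fact
  have po: "partial_order_on A r" and iso: "\<phi> \<in> iso H (poset_Aut A r)"
    and stab: "\<And>x. x \<in> A \<Longrightarrow> stabilizer H \<phi> x = {\<one>\<^bsub>H\<^esub>}"
    and orb: "\<exists>!U. U \<in> orbits H A \<phi>"
    using rep unfolding regular_poset_representation_def poset_representation_def by simp_all
  have \<phi>_Aut: "\<phi> g \<in> carrier (poset_Aut A r)" if "g \<in> carrier H" for g
    using iso that by (auto simp: iso_def bij_betw_def)
  then have \<phi>_bij: "bij_betw (\<phi> g) A A" if "g \<in> carrier H" for g
    using that by (auto simp: carrier_poset_Aut Bij_def)
  then have \<phi>_closed: "\<phi> g x \<in> A" if "g \<in> carrier H" "x \<in> A" for g x
    using that by (meson bij_betwE)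
  have \<phi>_mult: "\<phi> (g \<otimes>\<^bsub>H\<^esub> h) x = \<phi> g (\<phi> h x)"
    if "g \<in> carrier H" "h \<in> carrier H" "x \<in> A" for g h x
    using iso \<phi>_Aut that by (auto simp: iso_def hom_def mult_poset_Aut compose_def)
  have \<phi>_ord: "(\<phi> g x, \<phi> g y) \<in> r \<longleftrightarrow> (x, y) \<in> r"
    if "g \<in> carrier H" "x \<in> A" "y \<in> A" for g x y
    using \<phi>_Aut that by (auto simp: carrier_poset_Aut)
  have \<phi>_one: "\<phi> \<one>\<^bsub>H\<^esub> x = x" if "x \<in> A" for x
    using stab[OF that] by (auto simp: stabilizer_def)
  obtain Q where Q: "Q \<in> orbits H A \<phi>" "\<And>U. U \<in> orbits H A \<phi> \<Longrightarrow> U = Q"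
    using orb by (metis (no_types))
  obtain p where p: "p \<in> A" using Q(1) unfolding orbits_def by blast
  define b where "b h = \<phi> h p" for h
  have b_mult: "b (g \<otimes>\<^bsub>H\<^esub> h) = \<phi> g (b h)" if "g \<in> carrier H" "h \<in> carrier H" for g h
    using \<phi>_mult that p by (simp add: b_def)
  have b_inj: "inj_on b (carrier H)"
  proof (rule inj_onI)
    fix g h assume gh: "g \<in> carrier H" "h \<in> carrier H" "b g = b h"
    define k where "k = inv\<^bsub>H\<^esub> g"
    have k: "k \<in> carrier H" "k \<otimes>\<^bsub>H\<^esub> g = \<one>\<^bsub>H\<^esub>" using gh(1) by (simp_all add: k_def)
    have "b (k \<otimes>\<^bsub>H\<^esub> h) = b (k \<otimes>\<^bsub>H\<^esub> g)"
      unfolding b_mult[OF k(1) gh(1)] b_mult[OF k(1) gh(2)] gh(3) by (rule refl)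
    then have "\<phi> (k \<otimes>\<^bsub>H\<^esub> h) p = p"
      unfolding k(2) b_def \<phi>_one[OF p] .
    then have "k \<otimes>\<^bsub>H\<^esub> h \<in> stabilizer H \<phi> p"
      unfolding stabilizer_def using k(1) gh(2) by blast
    then have "inv\<^bsub>H\<^esub> g \<otimes>\<^bsub>H\<^esub> h = \<one>\<^bsub>H\<^esub>"
      unfolding stab[OF p] k_def by simp
    then have "g \<otimes>\<^bsub>H\<^esub> (inv\<^bsub>H\<^esub> g \<otimes>\<^bsub>H\<^esub> h) = g"
      using gh(1) by simp
    then show "g = h" using gh(1,2) by (simp add: m_assoc[symmetric])
  qed
  have b_surj: "b ` carrier H = A"
  proof
    show "b ` carrier H \<subseteq> A" using \<phi>_closed p by (auto simp: b_def)
    show "A \<subseteq> b ` carrier H"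
    proof
      fix x assume x: "x \<in> A"
      have "orbit H \<phi> x = orbit H \<phi> p" 
        using Q(2)[of "orbit H \<phi> x"] Q(2)[of "orbit H \<phi> p"] x p unfolding orbits_def by blast
      moreover have "x \<in> orbit H \<phi> x"
        unfolding orbit_def using \<phi>_one[OF x, symmetric] one_closed by blast
      ultimately show "x \<in> b ` carrier H" unfolding orbit_def b_def by blast
    qed
  qed
  then have b_A: "b g \<in> A" if "g \<in> carrier H" for g using that by blast
  define r' where "r' = {(g, h). g \<in> carrier H \<and> h \<in> carrier H \<and> (b g, b h) \<in> r}"
  define \<theta> where "\<theta> g = restrict (\<lambda>h. g \<otimes>\<^bsub>H\<^esub> h) (carrier H)" for g
  have po': "partial_order_on (carrier H) r'"
  proof -
    have "refl_on (carrier H) r'"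
      using po b_A by (auto simp: partial_order_on_def preorder_on_def refl_on_def r'_def)
    moreover have "trans r'"
      using po unfolding partial_order_on_def preorder_on_def trans_def r'_def by blast
    moreover have "antisym r'"
      using po b_inj unfolding partial_order_on_def antisym_def r'_def inj_on_def by blast
    ultimately show ?thesis
      by (auto simp: partial_order_on_def preorder_on_def r'_def)
  qed
  have \<theta>_Aut: "\<theta> g \<in> carrier (poset_Aut (carrier H) r')" if g: "g \<in> carrier H" for g
  proof -
    have "bij_betw (\<theta> g) (carrier H) (carrier H)"
      using inj_on_multc surj_const_mult[OF g] inj_on_cmult[OF g]
      by (auto simp: bij_betw_def \<theta>_def inj_on_def)
    then show ?thesis
      using g b_mult \<phi>_ord b_A by (auto simp: carrier_poset_Aut Bij_def \<theta>_def r'_def)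
  qed
  have "\<theta> \<in> hom H (poset_Aut (carrier H) r')"
    using \<theta>_Aut by (auto simp: hom_def mult_poset_Aut compose_def \<theta>_def m_assoc fun_eq_iff)
  moreover have "inj_on \<theta> (carrier H)"
  proof (rule inj_onI)
    fix g h assume gh: "g \<in> carrier H" "h \<in> carrier H" "\<theta> g = \<theta> h"
    then have "\<theta> g \<one>\<^bsub>H\<^esub> = \<theta> h \<one>\<^bsub>H\<^esub>" by simp
    then show "g = h" using gh by (simp add: \<theta>_def)
  qed
  moreover have "carrier (poset_Aut (carrier H) r') \<subseteq> \<theta> ` carrier H"
  proof
    fix f assume f: "f \<in> carrier (poset_Aut (carrier H) r')"
    then have f_bij: "bij_betw f (carrier H) (carrier H)" and f_ext: "f \<in> extensional (carrier H)"
      and f_ord: "\<And>x y. x \<in> carrier H \<Longrightarrow> y \<in> carrier H \<Longrightarrow> (f x, f y) \<in> r' \<longleftrightarrow> (x, y) \<in> r'"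
      by (auto simp: carrier_poset_Aut Bij_def)
    define c where "c = inv_into (carrier H) b"
    have b_bij: "bij_betw b (carrier H) A" using b_inj b_surj by (simp add: bij_betw_def)
    then have c_bij: "bij_betw c A (carrier H)" by (simp add: c_def bij_betw_inv_into)
    have cb: "c (b h) = h" if "h \<in> carrier H" for h
      using that b_inj by (simp add: c_def)
    have bc: "b (c x) = x" if "x \<in> A" for x
      using that b_surj by (simp add: c_def f_inv_into_f)
    have c_H: "c x \<in> carrier H" if "x \<in> A" for x using that c_bij by (meson bij_betwE)
    have f_H: "f h \<in> carrier H" if "h \<in> carrier H" for h using that f_bij by (meson bij_betwE)
    define F where "F = restrict (b \<circ> f \<circ> c) A"
    have "bij_betw (b \<circ> f \<circ> c) A A"
      using bij_betw_trans[OF c_bij bij_betw_trans[OF f_bij b_bij]] by (simp add: comp_assoc)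
    then have "F \<in> Bij A" by (auto simp: Bij_def F_def)
    moreover have "(F x, F y) \<in> r \<longleftrightarrow> (x, y) \<in> r" if "x \<in> A" "y \<in> A" for x y
      using f_ord[of "c x" "c y"] that c_H f_H bc by (simp add: r'_def F_def)
    ultimately have "F \<in> carrier (poset_Aut A r)" by (simp add: carrier_poset_Aut)
    then obtain g where g: "g \<in> carrier H" "F = \<phi> g"
      using iso by (auto simp: iso_def bij_betw_def)
    have "f h = g \<otimes>\<^bsub>H\<^esub> h" if h: "h \<in> carrier H" for h
    proof -
      have "b (f h) = F (b h)" using h b_A cb by (simp add: F_def)
      also have "\<dots> = b (g \<otimes>\<^bsub>H\<^esub> h)" using g h b_mult by simp
      finally show ?thesis using b_inj f_H g h by (auto simp: inj_on_def)
    qed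
    then have "f = \<theta> g"
      using f_ext by (auto simp: \<theta>_def extensional_def fun_eq_iff)
    then show "f \<in> \<theta> ` carrier H" using g by blast
  qed
  ultimately have "\<theta> \<in> iso H (poset_Aut (carrier H) r')"
    using \<theta>_Aut by (auto simp: iso_def bij_betw_def)
  moreover have "stabilizer H \<theta> x = {\<one>\<^bsub>H\<^esub>}" if "x \<in> carrier H" for x
    using that by (auto simp: stabilizer_def \<theta>_def r_cancel_one)
  moreover have "\<exists>!U. U \<in> orbits H (carrier H) \<theta>"
  proof -
    have "orbit H \<theta> x = carrier H" if x: "x \<in> carrier H" for x
    proof -
      have "y \<in> orbit H \<theta> x" if y: "y \<in> carrier H" for y
      proof -
        have "y \<otimes>\<^bsub>H\<^esub> inv\<^bsub>H\<^esub> x \<in> carrier H" using x y by simp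
        moreover have "y = \<theta> (y \<otimes>\<^bsub>H\<^esub> inv\<^bsub>H\<^esub> x) x"
          using x y by (simp add: \<theta>_def m_assoc)
        ultimately show ?thesis unfolding orbit_def by (intro CollectI exI conjI)
      qed
      then have "carrier H \<subseteq> orbit H \<theta> x" by (rule subsetI)
      moreover have "orbit H \<theta> x \<subseteq> carrier H"
        using x by (auto simp: orbit_def \<theta>_def)
      ultimately show ?thesis by (rule subset_antisym[rotated])
    qed
    then have "orbits H (carrier H) \<theta> = (\<lambda>x. carrier H) ` carrier H"
      unfolding orbits_def by (simp add: Setcompr_eq_image)
    then have "orbits H (carrier H) \<theta> = {carrier H}"
      using one_closed by (simp add: image_constant_conv carrier_not_empty)
    then show ?thesis by simp
  qed
  ultimately have "regular_poset_representation H (carrier H) r' \<theta>"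
    using po' by (simp add: regular_poset_representation_def poset_representation_def)
  then show ?thesis
    unfolding admits_regular_poset_representation_def by (intro exI)
qed

lemma group_semidirect_product:
  assumes "group G" "group H" and \<psi>: "\<psi> \<in> hom H (AutoGroup G)"
  shows "group (semidirect_product G H \<psi>)"
proof -
  interpret G: group G by fact
  interpret H: group H by fact
  interpret \<psi>: group_hom H "AutoGroup G" \<psi>
    using \<psi> G.AutoGroup by (simp add: group_hom_def group_hom_axioms_def assms)
  have aut: "\<psi> h \<in> auto G" if "h \<in> carrier H" for h
    using \<psi>.hom_closed[OF that] by (simp add: AutoGroup_def)
  have closed: "\<psi> h g \<in> carrier G" if "h \<in> carrier H" "g \<in> carrier G" for h g
    using aut that by (auto simp: auto_def hom_def)
  have mult: "\<psi> h (x \<otimes>\<^bsub>G\<^esub> y) = \<psi> h x \<otimes>\<^bsub>G\<^esub> \<psi> h y"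
    if "h \<in> carrier H" "x \<in> carrier G" "y \<in> carrier G" for h x y
    using aut that by (auto simp: auto_def hom_def)
  have comp: "\<psi> (h \<otimes>\<^bsub>H\<^esub> k) g = \<psi> h (\<psi> k g)"
    if "h \<in> carrier H" "k \<in> carrier H" "g \<in> carrier G" for h k g
    using \<psi>.hom_mult[of h k] that aut
    by (auto simp: AutoGroup_def BijGroup_def auto_def compose_def)
  have one: "\<psi> \<one>\<^bsub>H\<^esub> g = g" if "g \<in> carrier G" for g
    using \<psi>.hom_one that by (simp add: AutoGroup_def BijGroup_def)
  show ?thesis
  proof (rule groupI, goal_cases)
    case (5 x)
    then obtain g h where x: "x = (g, h)" "g \<in> carrier G" "h \<in> carrier H"
      by (auto simp: semidirect_product_def)
    define k where "k = inv\<^bsub>H\<^esub> h"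
    have k: "k \<in> carrier H" "k \<otimes>\<^bsub>H\<^esub> h = \<one>\<^bsub>H\<^esub>" using x by (simp_all add: k_def)
    let ?y = "(\<psi> k (inv\<^bsub>G\<^esub> g), k)"
    have "\<psi> k \<one>\<^bsub>G\<^esub> \<otimes>\<^bsub>G\<^esub> \<psi> k \<one>\<^bsub>G\<^esub> = \<psi> k \<one>\<^bsub>G\<^esub>"
      using mult[OF k(1) G.one_closed G.one_closed] by simp
    then have "\<psi> k \<one>\<^bsub>G\<^esub> = \<one>\<^bsub>G\<^esub>"
      using closed[OF k(1) G.one_closed] by (simp add: G.r_cancel_one)
    then have inv: "\<psi> k (inv\<^bsub>G\<^esub> g) \<otimes>\<^bsub>G\<^esub> \<psi> k g = \<one>\<^bsub>G\<^esub>"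
      using mult[OF k(1) G.inv_closed[OF x(2)] x(2)] x(2) by simp
    have "?y \<in> carrier (semidirect_product G H \<psi>)"
      using x k closed by (simp add: semidirect_product_def)
    moreover have "?y \<otimes>\<^bsub>semidirect_product G H \<psi>\<^esub> x = \<one>\<^bsub>semidirect_product G H \<psi>\<^esub>"
      using x k inv by (simp add: semidirect_product_def)
    ultimately show ?case by blast
  next
    case (1 x y)
    then show ?case using closed by (auto simp: semidirect_product_def)
  next
    case 2
    then show ?case by (simp add: semidirect_product_def)
  next
    case (3 x y z)
    then show ?case using closed
      by (auto simp: semidirect_product_def mult comp G.m_assoc H.m_assoc simp del: \<psi>.hom_mult)
  next
    case (4 x)
    then show ?case by (auto simp: semidirect_product_def one simp del: \<psi>.hom_one)
  qed
qed

end

theory Submission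
  imports Defs "HOL-Combinatorics.Transposition"
begin

text \<open>The order on \<open>G \<rtimes> \<int>\<close> is generated by the relations \<open>x < x(s,1)\<close> for \<open>s \<in> S\<close>, so that two
  consecutive levels \<open>G \<times> {n}\<close> and \<open>G \<times> {n + 1}\<close> carry a copy of \<open>P(G,S)\<close>. These relations are
  exactly the covers, so an automorphism preserves them; if \<open>P(G,S)\<close> is connected, it therefore
  shifts all levels by the same amount, and since \<open>P(G,S)\<close> is a Cayley representation, it acts
  on each pair of consecutive levels as a left translation, which extends to all levels.

  If \<open>P(G,S)\<close> is disconnected, then \<open>S\<close> is replaced by its complement, which has the same
  side-preserving automorphisms. If both are disconnected, then \<open>P(G,S)\<close> consists of two
  complete bipartite components; as no two elements have the same upper bounds, \<open>G\<close> has only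
  two elements.\<close>

section \<open>Rigidity and connectedness of Cayley posets\<close>

text \<open>The pair \<open>a\<close>, \<open>b\<close> stands for an automorphism of P(G,S) that
  keeps each copy of G, with h \<in> gS written as \<open>inv g \<otimes> h \<in> S\<close>.
  Building the two sides into the condition makes it symmetric under complementing
  \<open>S\<close>.\<close>

definition cayley_rigid :: "('a, 'b) monoid_scheme \<Rightarrow> 'a set \<Rightarrow> bool" where
  "cayley_rigid G S \<longleftrightarrow> (\<forall>a b. bij_betw a (carrier G) (carrier G) \<longrightarrow>
     bij_betw b (carrier G) (carrier G) \<longrightarrow>
     (\<forall>g\<in>carrier G. \<forall>h\<in>carrier G.
        inv\<^bsub>G\<^esub> (a g) \<otimes>\<^bsub>G\<^esub> b h \<in> S \<longleftrightarrow> inv\<^bsub>G\<^esub> g \<otimes>\<^bsub>G\<^esub> h \<in> S) \<longrightarrow>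
     (\<exists>k\<in>carrier G. \<forall>g\<in>carrier G. a g = k \<otimes>\<^bsub>G\<^esub> g \<and> b g = k \<otimes>\<^bsub>G\<^esub> g))"

text \<open>The predicates \<open>p\<close> and \<open>q\<close> are the restrictions to the two copies of \<open>G\<close> of a union of
  connected components.\<close>

definition cayley_connected :: "('a, 'b) monoid_scheme \<Rightarrow> 'a set \<Rightarrow> bool" where
  "cayley_connected G S \<longleftrightarrow> (\<forall>p q. (\<forall>g\<in>carrier G. \<forall>h\<in>carrier G.
        inv\<^bsub>G\<^esub> g \<otimes>\<^bsub>G\<^esub> h \<in> S \<longrightarrow> p g = q h) \<longrightarrow>
     (\<forall>g\<in>carrier G. \<forall>h\<in>carrier G. p g = (q h :: bool)))"

lemma cayley_rigidD:
  assumes "cayley_rigid G S"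
    and "bij_betw a (carrier G) (carrier G)" "bij_betw b (carrier G) (carrier G)"
    and "\<And>g h. g \<in> carrier G \<Longrightarrow> h \<in> carrier G \<Longrightarrow>
           inv\<^bsub>G\<^esub> (a g) \<otimes>\<^bsub>G\<^esub> b h \<in> S \<longleftrightarrow> inv\<^bsub>G\<^esub> g \<otimes>\<^bsub>G\<^esub> h \<in> S"
  obtains k where "k \<in> carrier G" "\<And>g. g \<in> carrier G \<Longrightarrow> a g = k \<otimes>\<^bsub>G\<^esub> g"
    "\<And>g. g \<in> carrier G \<Longrightarrow> b g = k \<otimes>\<^bsub>G\<^esub> g"
proof -
  have "\<exists>k\<in>carrier G. \<forall>g\<in>carrier G. a g = k \<otimes>\<^bsub>G\<^esub> g \<and> b g = k \<otimes>\<^bsub>G\<^esub> g"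
    using assms(1)[unfolded cayley_rigid_def, rule_format, OF assms(2,3)] assms(4) by blast
  then show thesis using that by blast
qed

text \<open>Labellings with values in any type reduce to two-valued ones by testing for equality
  with the single value \<open>p g\<close>.\<close>

lemma cayley_connectedD:
  assumes "cayley_connected G S"
    and "\<And>g h. g \<in> carrier G \<Longrightarrow> h \<in> carrier G \<Longrightarrow> inv\<^bsub>G\<^esub> g \<otimes>\<^bsub>G\<^esub> h \<in> S \<Longrightarrow> p g = q h"
    and "g \<in> carrier G" "h \<in> carrier G"
  shows "p g = q h"
proof -
  have "(p x = p g) = (q y = p g)" if "x \<in> carrier G" "y \<in> carrier G" for x y
    using assms(1)[unfolded cayley_connected_def, rule_format,
        of "\<lambda>x. p x = p g" "\<lambda>y. q y = p g"] assms(2) that by metis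
  then show ?thesis using assms(3,4) by metis
qed

section \<open>Rigidity, complements and the disconnected case\<close>

context group
begin

lemma mem_l_coset_iff:
  assumes "S \<subseteq> carrier G" "g \<in> carrier G" "h \<in> carrier G"
  shows "h \<in> g <# S \<longleftrightarrow> inv g \<otimes> h \<in> S"
proof
  assume "h \<in> g <# S"
  then obtain s where "s \<in> S" "h = g \<otimes> s" by (auto simp: l_coset_def)
  then show "inv g \<otimes> h \<in> S" using assms by (auto simp: m_assoc[symmetric] subset_iff)
next
  assume "inv g \<otimes> h \<in> S"
  moreover have "h = g \<otimes> (inv g \<otimes> h)" using assms by (simp add: m_assoc[symmetric])
  ultimately show "h \<in> g <# S" unfolding l_coset_def by blast
qed

text \<open>Glued together on the two copies of G, \<open>a\<close> and \<open>b\<close> form an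
  order automorphism \<open>F\<close> of P(G,S). It is a left translation by assumption, and reading
  it on each copy gives the same \<open>k\<close>.\<close>

lemma cayley_representation_imp_rigid:
  assumes "is_cayley_representation G S"
  shows "cayley_rigid G S"
  unfolding cayley_rigid_def
proof (intro allI impI)
  fix a b
  assume a: "bij_betw a (carrier G) (carrier G)" and b: "bij_betw b (carrier G) (carrier G)"
    and edge: "\<forall>g\<in>carrier G. \<forall>h\<in>carrier G. inv (a g) \<otimes> b h \<in> S \<longleftrightarrow> inv g \<otimes> h \<in> S"
  have S: "S \<subseteq> carrier G" using assms by (simp add: is_cayley_representation_def)
  have aG: "a g \<in> carrier G" and bG: "b g \<in> carrier G" if "g \<in> carrier G" for g
    using a b that by (meson bij_betwE)+
  let ?P = "cayley_points G"
  define F where "F = restrict (map_sum a b) ?P"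
  have F_Inl: "F (Inl g) = Inl (a g)" and F_Inr: "F (Inr g) = Inr (b g)"
    if "g \<in> carrier G" for g
    using that by (simp_all add: F_def cayley_points_def InlI InrI)
  have bij: "bij_betw F ?P ?P"
    unfolding bij_betw_def
  proof
    show "inj_on F ?P"
      unfolding cayley_points_def
    proof (rule inj_onI)
      fix u v assume "u \<in> carrier G <+> carrier G" "v \<in> carrier G <+> carrier G" "F u = F v"
      then show "u = v"
        using bij_betw_imp_inj_on[OF a] bij_betw_imp_inj_on[OF b]
        by (elim PlusE) (simp_all add: F_Inl F_Inr inj_on_eq_iff)
    qed
    have "F ` Inl ` carrier G = Inl ` a ` carrier G" "F ` Inr ` carrier G = Inr ` b ` carrier G"
      by (simp_all add: image_image F_Inl F_Inr)
    then show "F ` ?P = ?P"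
      using bij_betw_imp_surj_on[OF a] bij_betw_imp_surj_on[OF b]
      by (simp add: cayley_points_def Plus_def image_Un)
  qed
  have le_iff: "(u, v) \<in> cayley_le G S \<longleftrightarrow> u = v \<or>
      (\<exists>g\<in>carrier G. \<exists>h\<in>carrier G. u = Inl g \<and> v = Inr h \<and> inv g \<otimes> h \<in> S)"
    if "u \<in> ?P" "v \<in> ?P" for u v
    using that S by (auto simp: cayley_le_def mem_l_coset_iff)
  have F_closed: "F u \<in> ?P" if "u \<in> ?P" for u using bij that by (rule bij_betw_apply)
  have "(F u, F v) \<in> cayley_le G S \<longleftrightarrow> (u, v) \<in> cayley_le G S" if uv: "u \<in> ?P" "v \<in> ?P" for u v
  proof -
    note iff = le_iff[OF uv] le_iff[OF F_closed[OF uv(1)] F_closed[OF uv(2)]]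
    have eq: "F u = F v \<longleftrightarrow> u = v" using bij_betw_imp_inj_on[OF bij] uv by (simp add: inj_on_eq_iff)
    \<comment> \<open>Strict comparabilities lead only from the first copy to the second. In the
      last two cases the order is equality, which the injective \<open>F\<close> preserves and
      reflects.\<close>
    consider g h where "u = Inl g" "v = Inr h" "g \<in> carrier G" "h \<in> carrier G"
      | g where "u = Inr g" "g \<in> carrier G" | h where "v = Inl h" "h \<in> carrier G"
      using uv by (auto simp: cayley_points_def)
    then show ?thesis
    proof cases
      case 1
      then show ?thesis
        unfolding iff using edge aG bG by (simp add: F_Inl F_Inr)
    next
      case 2
      then show ?thesis
        unfolding iff using eq by (simp add: F_Inr)
    next
      case 3
      then show ?thesis
        unfolding iff using eq by (simp add: F_Inl)
    qed
  qed
  then have "F \<in> carrier (poset_Aut ?P (cayley_le G S))"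
    using bij by (simp add: carrier_poset_Aut Bij_def F_def)
  then obtain k where k: "k \<in> carrier G" "F = cayley_translation G k"
    using assms by (auto simp: is_cayley_representation_def)
  have "a g = k \<otimes> g \<and> b g = k \<otimes> g" if "g \<in> carrier G" for g
  proof -
    have "F (Inl g) = Inl (k \<otimes> g)" "F (Inr g) = Inr (k \<otimes> g)"
      using k that by (auto simp: cayley_translation_def cayley_points_def)
    then show ?thesis using that by (simp add: F_Inl F_Inr)
  qed
  then show "\<exists>k\<in>carrier G. \<forall>g\<in>carrier G. a g = k \<otimes> g \<and> b g = k \<otimes> g"
    using k by blast
qed

text \<open>All the quotients lie in \<open>carrier G\<close>, so preserving membership in the
  complement is the same as preserving membership in \<open>S\<close>.\<close>

lemma cayley_rigid_complement:
  assumes "cayley_rigid G S"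
  shows "cayley_rigid G (carrier G - S)"
  unfolding cayley_rigid_def
proof (intro allI impI)
  fix a b
  assume a: "bij_betw a (carrier G) (carrier G)" and b: "bij_betw b (carrier G) (carrier G)"
    and edge: "\<forall>g\<in>carrier G. \<forall>h\<in>carrier G.
      inv (a g) \<otimes> b h \<in> carrier G - S \<longleftrightarrow> inv g \<otimes> h \<in> carrier G - S"
  have "a g \<in> carrier G" "b g \<in> carrier G" if "g \<in> carrier G" for g
    using a b that by (meson bij_betwE)+
  then have "inv (a g) \<otimes> b h \<in> S \<longleftrightarrow> inv g \<otimes> h \<in> S"
    if "g \<in> carrier G" "h \<in> carrier G" for g h
    using edge that by auto
  from cayley_rigidD[OF assms a b this]
  show "\<exists>k\<in>carrier G. \<forall>g\<in>carrier G. a g = k \<otimes> g \<and> b g = k \<otimes> g" by metis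
qed

text \<open>Swapping two twins in the lower copy and fixing the upper copy preserves all edges. By
  rigidity both copies move by the same translation, so the swap is trivial too.\<close>

lemma cayley_rigid_imp_twin_free:
  assumes rigid: "cayley_rigid G S" and xy: "x \<in> carrier G" "y \<in> carrier G"
    and twin: "\<And>h. h \<in> carrier G \<Longrightarrow> inv x \<otimes> h \<in> S \<longleftrightarrow> inv y \<otimes> h \<in> S"
  shows "x = y"
proof -
  let ?a = "transpose x y"
  have a: "bij_betw ?a (carrier G) (carrier G)"
    using xy by (simp add: bij_betw_transpose_iff)
  have b: "bij_betw id (carrier G) (carrier G)" by simp
  have "inv (?a g) \<otimes> id h \<in> S \<longleftrightarrow> inv g \<otimes> h \<in> S"
    if "g \<in> carrier G" "h \<in> carrier G" for g h
    using twin that by (auto simp: transpose_def)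
  from cayley_rigidD[OF rigid a b this] obtain k where k: "k \<in> carrier G"
    "\<And>g. g \<in> carrier G \<Longrightarrow> ?a g = k \<otimes> g" "\<And>g. g \<in> carrier G \<Longrightarrow> id g = k \<otimes> g"
    by metis
  then have "?a x = x" using xy by (metis id_apply)
  then show ?thesis by simp
qed

text \<open>Take a nonconstant two-colouring \<open>p\<close>, \<open>q\<close> along the edges of
  \<open>S\<close> and another, \<open>p'\<close>, \<open>q'\<close>, along the edges of the
  complement. Together they force the edges of \<open>S\<close> to be exactly the pairs of equal
  colour, so elements of equal colour are twins.\<close>

lemma disconnected_imp_two_elements:
  assumes rigid: "cayley_rigid G S" and S: "S \<subseteq> carrier G" "S \<noteq> {}"
    and disc: "\<not> cayley_connected G S" and disc': "\<not> cayley_connected G (carrier G - S)"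
  shows "\<exists>x. x \<noteq> \<one> \<and> carrier G = {\<one>, x}"
proof -
  obtain p q u v where
    p: "\<And>g h. g \<in> carrier G \<Longrightarrow> h \<in> carrier G \<Longrightarrow> inv g \<otimes> h \<in> S \<Longrightarrow> p g = (q h :: bool)"
    and uv: "u \<in> carrier G" "v \<in> carrier G" "p u \<noteq> q v"
    using disc unfolding cayley_connected_def by blast
  obtain p' q' u' v' where
    p': "\<And>g h. g \<in> carrier G \<Longrightarrow> h \<in> carrier G \<Longrightarrow> inv g \<otimes> h \<notin> S \<Longrightarrow> p' g = (q' h :: bool)"
    and uv': "u' \<in> carrier G" "v' \<in> carrier G" "p' u' \<noteq> q' v'"
  proof -
    have "inv g \<otimes> h \<in> carrier G - S \<longleftrightarrow> inv g \<otimes> h \<notin> S"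
      if "g \<in> carrier G" "h \<in> carrier G" for g h
      using that by simp
    then have "\<exists>p q. (\<forall>g\<in>carrier G. \<forall>h\<in>carrier G. inv g \<otimes> h \<notin> S \<longrightarrow> p g = q h) \<and>
        (\<exists>u\<in>carrier G. \<exists>v\<in>carrier G. p u \<noteq> (q v :: bool))"
      using disc' unfolding cayley_connected_def by (simp cong: ball_cong)
    then show thesis using that by blast
  qed
  \<comment> \<open>Since \<open>S\<close> is nonempty, every point of either copy lies on an edge,
    so \<open>p\<close> and \<open>q\<close> take the same values.\<close>
  obtain s where s: "s \<in> S" "s \<in> carrier G" using S by blast
  have right: "\<exists>h\<in>carrier G. q h = p g" if "g \<in> carrier G" for g
    using p[of g "g \<otimes> s"] s that by (auto simp: m_assoc[symmetric])
  have left: "\<exists>g\<in>carrier G. p g = q h" if "h \<in> carrier G" for h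
    using p[of "h \<otimes> inv s" h] s that by (auto simp: inv_mult_group m_assoc)
  have cross: "p' g = q' h" if "g \<in> carrier G" "h \<in> carrier G" "p g \<noteq> q h" for g h
    using p p' that by blast
  \<comment> \<open>A point \<open>h\<close> of the opposite colour is joined to neither element by
    \<open>S\<close>, so both share its colour in the second colouring.\<close>
  have p'_eq: "p' g = p' g'" if "g \<in> carrier G" "g' \<in> carrier G" "p g = p g'" for g g'
  proof -
    obtain h where h: "h \<in> carrier G" "q h \<noteq> p g"
      using uv right[OF uv(1)] by (cases "p g = p u") auto
    then show ?thesis using cross[of g h] cross[of g' h] that by simp
  qed
  have q'_eq: "q' h = q' h'" if "h \<in> carrier G" "h' \<in> carrier G" "q h = q h'" for h h'
  proof -
    obtain g where g: "g \<in> carrier G" "p g \<noteq> q h"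
      using uv left[OF uv(2)] by (cases "q h = q v") auto
    then show ?thesis using cross[of g h] cross[of g h'] that by simp
  qed
  \<comment> \<open>One coincidence within a colour class would make \<open>p'\<close> and
    \<open>q'\<close> constant with the same value: \<open>p'_eq\<close> and \<open>q'_eq\<close>
    spread it within the class, \<open>cross\<close> to the other class.\<close>
  have p'_neq: "p' g \<noteq> q' h" if gh: "g \<in> carrier G" "h \<in> carrier G" "p g = q h" for g h
  proof
    assume eq: "p' g = q' h"
    have "p' x = p' g" if "x \<in> carrier G" for x
      using p'_eq[OF that gh(1)] cross[OF that gh(2)] gh(3) eq by fastforce
    moreover have "q' x = p' g" if "x \<in> carrier G" for x
      using q'_eq[OF that gh(2)] cross[OF gh(1) that] gh(3) eq by fastforce
    ultimately show False using uv' by simp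
  qed
  have complete: "inv g \<otimes> h \<in> S \<longleftrightarrow> p g = q h" if "g \<in> carrier G" "h \<in> carrier G" for g h
    using p[OF that] p'[OF that] p'_neq[OF that] by auto
  have p_inj: "g = g'" if "g \<in> carrier G" "g' \<in> carrier G" "p g = p g'" for g g'
    using cayley_rigid_imp_twin_free[OF rigid that(1,2)] complete that by simp
  \<comment> \<open>The elements \<open>u\<close> and \<open>w\<close> realize both values of
    \<open>p\<close>, which is injective by \<open>p_inj\<close>.\<close>
  obtain w where w: "w \<in> carrier G" "p w \<noteq> p u" using left[OF uv(2)] uv(3) by metis
  have "carrier G = {u, w}" using p_inj w uv by blast
  moreover from this have "\<one> = u \<or> \<one> = w" using one_closed by simp
  ultimately show ?thesis using w(2) by (metis insert_commute)
qed

lemma two_elements_imp_iso: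
  assumes "x \<noteq> \<one>" and G: "carrier G = {\<one>, x}"
  shows "G \<cong> integer_mod_group 2"
proof -
  have x: "x \<in> carrier G" using G by simp
  then have "x \<otimes> x \<noteq> x" using assms(1) r_cancel_one by blast
  then have xx: "x \<otimes> x = \<one>" using m_closed[OF x x] G by auto
  let ?f = "\<lambda>y. if y = \<one> then 0 else (1::int)"
  have carr: "carrier (integer_mod_group 2) = {0, 1}"
    by (auto simp: carrier_integer_mod_group)
  have "?f \<in> hom G (integer_mod_group 2)"
    unfolding hom_def carr using assms x xx by (auto simp: integer_mod_group_def)
  moreover have "bij_betw ?f (carrier G) (carrier (integer_mod_group 2))"
    unfolding carr G using assms(1) by (auto simp: bij_betw_def inj_on_def)
  ultimately show ?thesis by (auto simp: is_iso_def iso_def)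
qed

text \<open>The set obtained is the given one or its complement: both are rigid, and they can both
  be disconnected only in a group of order 2.\<close>

lemma admits_imp_connected_rigid:
  assumes "admits_cayley_representation G" and "\<not> G \<cong> integer_mod_group 2"
  obtains S where "cayley_rigid G S" "cayley_connected G S"
proof -
  obtain S where S: "is_cayley_representation G S"
    using assms(1) by (auto simp: admits_cayley_representation_def)
  then have sub: "S \<subseteq> carrier G" "S \<noteq> {}" by (simp_all add: is_cayley_representation_def)
  have rigid: "cayley_rigid G S" using S by (rule cayley_representation_imp_rigid)
  have "cayley_connected G S \<or> cayley_connected G (carrier G - S)"
    using disconnected_imp_two_elements[OF rigid sub] two_elements_imp_iso assms(2) by blast
  then show thesis
    using that rigid cayley_rigid_complement[OF rigid] by blast
qed

section \<open>Orders invariant under left translations\<close>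

text \<open>The group serves as its own set of points: left translations act freely with one orbit.
  By \<open>inv\<close> they are automorphisms of \<open>r\<close>, and by \<open>aut\<close> there
  are no others.\<close>

lemma admits_regularI:
  assumes po: "partial_order_on (carrier G) r"
    and inv: "\<And>g x y. g \<in> carrier G \<Longrightarrow> x \<in> carrier G \<Longrightarrow> y \<in> carrier G \<Longrightarrow>
                (g \<otimes> x, g \<otimes> y) \<in> r \<longleftrightarrow> (x, y) \<in> r"
    and aut: "\<And>f. bij_betw f (carrier G) (carrier G) \<Longrightarrow>
                (\<And>x y. x \<in> carrier G \<Longrightarrow> y \<in> carrier G \<Longrightarrow> (f x, f y) \<in> r \<longleftrightarrow> (x, y) \<in> r) \<Longrightarrow>
                \<exists>k\<in>carrier G. \<forall>x\<in>carrier G. f x = k \<otimes> x"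
  shows "admits_regular_poset_representation G"
proof -
  let ?A = "poset_Aut (carrier G) r"
  define \<theta> where "\<theta> g = restrict (\<lambda>h. g \<otimes> h) (carrier G)" for g
  have \<theta>_Aut: "\<theta> g \<in> carrier ?A" if g: "g \<in> carrier G" for g
  proof -
    have "bij_betw (\<theta> g) (carrier G) (carrier G)"
      using surj_const_mult[OF g] inj_on_cmult[OF g]
      by (auto simp: bij_betw_def \<theta>_def inj_on_def)
    then show ?thesis
      using g inv by (auto simp: carrier_poset_Aut Bij_def \<theta>_def)
  qed
  have "\<theta> \<in> hom G ?A"
    using \<theta>_Aut by (auto simp: hom_def mult_poset_Aut compose_def \<theta>_def m_assoc fun_eq_iff)
  moreover have "inj_on \<theta> (carrier G)"
  proof (rule inj_onI)
    fix g h assume gh: "g \<in> carrier G" "h \<in> carrier G" "\<theta> g = \<theta> h"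
    then have "\<theta> g \<one> = \<theta> h \<one>" by simp
    then show "g = h" using gh by (simp add: \<theta>_def)
  qed
  moreover have "carrier ?A \<subseteq> \<theta> ` carrier G"
  proof
    fix f assume f: "f \<in> carrier ?A"
    then obtain k where k: "k \<in> carrier G" "\<forall>x\<in>carrier G. f x = k \<otimes> x"
      using aut[of f] by (auto simp: carrier_poset_Aut Bij_def)
    have "f \<in> extensional (carrier G)" using f by (auto simp: carrier_poset_Aut Bij_def)
    then have "f = \<theta> k"
      using k by (auto simp: \<theta>_def extensional_def fun_eq_iff)
    then show "f \<in> \<theta> ` carrier G" using k by blast
  qed
  ultimately have "\<theta> \<in> iso G ?A"
    using \<theta>_Aut by (auto simp: iso_def bij_betw_def)
  moreover have "stabilizer G \<theta> x = {\<one>}" if "x \<in> carrier G" for x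
    using that by (auto simp: stabilizer_def \<theta>_def r_cancel_one)
  moreover have "\<exists>!U. U \<in> orbits G (carrier G) \<theta>"
  proof -
    have "orbit G \<theta> x = carrier G" if x: "x \<in> carrier G" for x
    proof
      show "orbit G \<theta> x \<subseteq> carrier G"
        using x by (auto simp: orbit_def \<theta>_def)
      show "carrier G \<subseteq> orbit G \<theta> x"
      proof
        fix y assume "y \<in> carrier G"
        then have "y \<otimes> inv x \<in> carrier G" "y = \<theta> (y \<otimes> inv x) x"
          using x by (simp_all add: \<theta>_def m_assoc)
        then show "y \<in> orbit G \<theta> x" unfolding orbit_def by blast
      qed
    qed
    then have "orbits G (carrier G) \<theta> = {carrier G}"
      unfolding orbits_def using one_closed by blast
    then show ?thesis by simp
  qed
  ultimately show ?thesis
    unfolding admits_regular_poset_representation_def regular_poset_representation_def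
      poset_representation_def
    by (intro exI[of _ "carrier G"] exI[of _ r] exI[of _ \<theta>] conjI ballI po)
qed

end

section \<open>Orders generated by graded relations\<close>

text \<open>Growth of the level along paths makes the generated order antisymmetric; growth by
  exactly one per edge leaves no room for a point inside an edge.\<close>

locale graded_relation =
  fixes C :: "'a set" and E :: "'a rel" and level :: "'a \<Rightarrow> int"
  assumes E_sub: "E \<subseteq> C \<times> C"
    and level_E: "(x, y) \<in> E \<Longrightarrow> level y = level x + 1"
begin

definition generated_order :: "'a rel" where
  "generated_order = Id_on C \<union> E\<^sup>+"

lemma trancl_carrier: "(x, y) \<in> E\<^sup>+ \<Longrightarrow> x \<in> C \<and> y \<in> C"
  using trancl_subset_Sigma[OF E_sub] by blast

lemma level_less: "(x, y) \<in> E\<^sup>+ \<Longrightarrow> level x < level y"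
  by (induction rule: trancl_induct) (auto dest: level_E)

lemma partial_order: "partial_order_on C generated_order"
  unfolding partial_order_on_def preorder_on_def
proof (intro conjI)
  show "generated_order \<subseteq> C \<times> C" using trancl_carrier by (auto simp: generated_order_def)
  show "refl_on C generated_order" by (auto simp: generated_order_def refl_on_def)
  show "trans generated_order"
    by (auto simp: generated_order_def trans_def intro: trancl_trans)
  show "antisym generated_order"
    by (auto simp: generated_order_def antisym_def dest!: level_less)
qed

lemma strict_iff: "(x, y) \<in> E\<^sup>+ \<longleftrightarrow> (x, y) \<in> generated_order \<and> x \<noteq> y"
  by (auto simp: generated_order_def dest: level_less)

text \<open>A point between the ends of an edge would have an integer level strictly between two
  consecutive ones. Conversely, the last intermediate point of a longer path shows that its ends do
  not form a cover.\<close>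

lemma cover_iff: "(x, y) \<in> E \<longleftrightarrow> (x, y) \<in> E\<^sup>+ \<and> \<not> (\<exists>z\<in>C. (x, z) \<in> E\<^sup>+ \<and> (z, y) \<in> E\<^sup>+)"
proof
  assume xy: "(x, y) \<in> E"
  have "\<not> ((x, z) \<in> E\<^sup>+ \<and> (z, y) \<in> E\<^sup>+)" for z
    using level_less[of x z] level_less[of z y] level_E[OF xy] by auto
  then show "(x, y) \<in> E\<^sup>+ \<and> \<not> (\<exists>z\<in>C. (x, z) \<in> E\<^sup>+ \<and> (z, y) \<in> E\<^sup>+)" using xy by blast
next
  assume *: "(x, y) \<in> E\<^sup>+ \<and> \<not> (\<exists>z\<in>C. (x, z) \<in> E\<^sup>+ \<and> (z, y) \<in> E\<^sup>+)"
  then have "(x, y) \<in> E\<^sup>+" by simp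
  then show "(x, y) \<in> E"
  proof (cases rule: tranclE)
    case (step z)
    then show ?thesis using * trancl_carrier[of x z] by blast
  qed
qed

text \<open>The order determines \<open>E\<close> as its cover relation, and \<open>E\<close>
  generates the order.\<close>

lemma order_automorphism_iff:
  assumes f: "bij_betw f C C"
  shows "(\<forall>x\<in>C. \<forall>y\<in>C. (f x, f y) \<in> generated_order \<longleftrightarrow> (x, y) \<in> generated_order) \<longleftrightarrow>
    (\<forall>x\<in>C. \<forall>y\<in>C. (f x, f y) \<in> E \<longleftrightarrow> (x, y) \<in> E)" (is "?L \<longleftrightarrow> ?R")
proof
  have fC: "f x \<in> C" if "x \<in> C" for x using f that by (meson bij_betwE)
  have inj: "f x = f y \<longleftrightarrow> x = y" if "x \<in> C" "y \<in> C" for x y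
    using f that by (auto simp: bij_betw_def inj_on_def)
  have image: "(\<exists>z\<in>C. Q z) \<longleftrightarrow> (\<exists>z\<in>C. Q (f z))" for Q
    unfolding bex_simps(7)[of f C Q, symmetric] bij_betw_imp_surj_on[OF f] ..
  {
    assume L: ?L
    then have strict: "(f x, f y) \<in> E\<^sup>+ \<longleftrightarrow> (x, y) \<in> E\<^sup>+" if "x \<in> C" "y \<in> C" for x y
      using that inj by (simp add: strict_iff)
    show ?R
    proof (intro ballI)
      fix x y assume xy: "x \<in> C" "y \<in> C"
      have "(\<exists>z\<in>C. (f x, z) \<in> E\<^sup>+ \<and> (z, f y) \<in> E\<^sup>+) \<longleftrightarrow>
          (\<exists>z\<in>C. (x, z) \<in> E\<^sup>+ \<and> (z, y) \<in> E\<^sup>+)"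
        unfolding image[of "\<lambda>z. (f x, z) \<in> E\<^sup>+ \<and> (z, f y) \<in> E\<^sup>+"]
        using strict xy by blast
      then show "(f x, f y) \<in> E \<longleftrightarrow> (x, y) \<in> E"
        using strict[OF xy] cover_iff[of "f x" "f y"] cover_iff[of x y] by blast
    qed
  }
  {
    assume R: ?R
    have 1: "(f x, f y) \<in> E\<^sup>+" if "(x, y) \<in> E\<^sup>+" for x y
      using that
    proof (induction rule: trancl_induct)
      case (base y)
      then show ?case using R E_sub by blast
    next
      case (step y z)
      then have "(f y, f z) \<in> E" using R E_sub by blast
      then show ?case using step.IH by (rule trancl.trancl_into_trancl[rotated])
    qed
    \<comment> \<open>The hypothesis on \<open>E\<close> is an equivalence, so the inverse of
      \<open>f\<close> preserves \<open>E\<close> too and carries paths back.\<close>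
    define g where "g = inv_into C f"
    have gf: "g (f x) = x" if "x \<in> C" for x
      using f that by (simp add: g_def bij_betw_def)
    have fg: "f (g x) = x" "g x \<in> C" if "x \<in> C" for x
      using f that by (auto simp: g_def bij_betw_def f_inv_into_f inv_into_into)
    have step': "(g x, g y) \<in> E" if "(x, y) \<in> E" for x y
    proof -
      have "x \<in> C" "y \<in> C" using that E_sub by auto
      then show ?thesis using R fg that by metis
    qed
    have 2: "(g x, g y) \<in> E\<^sup>+" if "(x, y) \<in> E\<^sup>+" for x y
      using that
    proof (induction rule: trancl_induct)
      case (base y)
      then show ?case using step' by blast
    next
      case (step y z)
      then show ?case using step' by (meson trancl.trancl_into_trancl)
    qed
    have "(f x, f y) \<in> E\<^sup>+ \<longleftrightarrow> (x, y) \<in> E\<^sup>+" if "x \<in> C" "y \<in> C" for x y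
      using 1 2 gf that by metis
    then show ?L using inj fC by (auto simp: generated_order_def Id_on_iff)
  }
qed

end

section \<open>The semidirect product\<close>

locale int_action = group G for G :: "('a, 'b) monoid_scheme" (structure) +
  fixes \<psi> :: "int \<Rightarrow> 'a \<Rightarrow> 'a"
  assumes action: "\<psi> \<in> hom integer_group (AutoGroup G)"
begin

section \<open>The action of the integers on \<open>G\<close>\<close>

lemma act_auto: "\<psi> n \<in> auto G"
  using action by (auto simp: hom_def AutoGroup_def)

lemma act_closed [simp]: "g \<in> carrier G \<Longrightarrow> \<psi> n g \<in> carrier G"
  using act_auto[of n] by (auto simp: auto_def hom_def)

lemma act_mult:
  "g \<in> carrier G \<Longrightarrow> h \<in> carrier G \<Longrightarrow> \<psi> n (g \<otimes> h) = \<psi> n g \<otimes> \<psi> n h"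
  using act_auto[of n] by (auto simp: auto_def hom_def)

lemma act_add: "g \<in> carrier G \<Longrightarrow> \<psi> (m + n) g = \<psi> m (\<psi> n g)"
  using action act_auto by (auto simp: hom_def AutoGroup_def BijGroup_def auto_def compose_def)

lemma act_bij: "bij_betw (\<psi> n) (carrier G) (carrier G)"
  using act_auto[of n] by (auto simp: auto_def Bij_def)

text \<open>The map \<open>\<psi> 0\<close> is idempotent and injective.\<close>

lemma act_zero [simp]:
  assumes "g \<in> carrier G"
  shows "\<psi> 0 g = g"
  using act_add[OF assms, of 0 0] act_bij[of 0] assms
  by (auto simp: bij_betw_def inj_on_def)

lemma act_cancel [simp]:
  assumes "g \<in> carrier G"
  shows "\<psi> n (\<psi> (- n) g) = g" "\<psi> (- n) (\<psi> n g) = g"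
  using act_add[OF assms, of n "- n"] act_add[OF assms, of "- n" n] assms by simp_all

lemma act_inv:
  assumes "g \<in> carrier G"
  shows "\<psi> n (inv g) = inv (\<psi> n g)"
proof -
  have "\<psi> n \<in> hom G G" using act_auto[of n] by (simp add: auto_def)
  then have "group_hom G G (\<psi> n)" by (simp add: group_hom_def group_hom_axioms_def is_group)
  then show ?thesis using assms by (rule group_hom.hom_inv)
qed

section \<open>Coordinates and edges of the semidirect product\<close>

abbreviation H where "H \<equiv> semidirect_product G integer_group \<psi>"

lemma carrier_H: "carrier H = carrier G \<times> UNIV"
  by (simp add: semidirect_product_def)

lemma mult_H: "(g, m) \<otimes>\<^bsub>H\<^esub> (h, n) = (g \<otimes> \<psi> m h, m + n)"
  by (simp add: semidirect_product_def)

text \<open>For \<open>x = (g, n)\<close>, the elements \<open>x(s,1)\<close> with \<open>s \<in> S\<close> are \<open>(g \<psi>\<^sub>n(s), n + 1)\<close>.\<close>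

definition steps :: "'a set \<Rightarrow> ('a \<times> int) rel" where
  "steps S = {((g, n), (h, m)) | g n h m. g \<in> carrier G \<and> h \<in> carrier G \<and> m = n + 1 \<and>
     inv (\<psi> (- n) g) \<otimes> \<psi> (- n) h \<in> S}"

lemma graded_steps: "graded_relation (carrier H) (steps S) snd"
  by unfold_locales (auto simp: steps_def carrier_H)

text \<open>Edges come from right multiplication, which commutes with left multiplication. In
  coordinates the factor \<open>c\<close> cancels and \<open>\<psi> j\<close> is absorbed by the new
  level \<open>j + n\<close>.\<close>

lemma steps_mult_iff:
  assumes k: "k \<in> carrier H" and x: "x \<in> carrier H" and y: "y \<in> carrier H"
  shows "(k \<otimes>\<^bsub>H\<^esub> x, k \<otimes>\<^bsub>H\<^esub> y) \<in> steps S \<longleftrightarrow> (x, y) \<in> steps S"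
proof -
  obtain c j g n h m where eqs: "k = (c, j)" "x = (g, n)" "y = (h, m)"
    and G: "c \<in> carrier G" "g \<in> carrier G" "h \<in> carrier G"
    using assms by (auto simp: carrier_H)
  have "inv (c \<otimes> \<psi> j g) \<otimes> (c \<otimes> \<psi> j h) = inv (\<psi> j g) \<otimes> (inv c \<otimes> (c \<otimes> \<psi> j h))"
    using G by (simp add: inv_mult_group m_assoc)
  also have "\<dots> = \<psi> j (inv g \<otimes> h)"
    using G by (simp add: m_assoc[symmetric] act_mult act_inv)
  finally have "inv (c \<otimes> \<psi> j g) \<otimes> (c \<otimes> \<psi> j h) = \<psi> j (inv g \<otimes> h)" .
  then have "\<psi> (- (j + n)) (inv (c \<otimes> \<psi> j g) \<otimes> (c \<otimes> \<psi> j h)) = \<psi> (- (j + n) + j) (inv g \<otimes> h)"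
    using G by (simp only: act_add m_closed inv_closed)
  then have "inv (\<psi> (- (j + n)) (c \<otimes> \<psi> j g)) \<otimes> \<psi> (- (j + n)) (c \<otimes> \<psi> j h)
      = inv (\<psi> (- n) g) \<otimes> \<psi> (- n) h"
    using G by (simp add: act_mult act_inv)
  then show ?thesis using G unfolding eqs mult_H by (auto simp: steps_def)
qed

text \<open>The displacement \<open>d\<close> of levels is constant along edges, hence on each pair
  of consecutive levels, because these form a copy of the connected P(G,S). Overlapping pairs make
  it constant everywhere.\<close>

lemma steps_automorphism_shift:
  assumes conn: "cayley_connected G S"
    and step: "\<And>x y. (x, y) \<in> steps S \<Longrightarrow> (f x, f y) \<in> steps S"
  obtains j where "\<And>g n. g \<in> carrier G \<Longrightarrow> snd (f (g, n)) = n + j"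
proof -
  define d where "d x = snd (f x) - snd x" for x
  have d_step: "d x = d y" if "(x, y) \<in> steps S" for x y
    using that step[OF that] by (auto simp: steps_def d_def)
  have d_pair: "d (g, n) = d (h, n + 1)" if "g \<in> carrier G" "h \<in> carrier G" for g h n
  proof -
    \<comment> \<open>Applying \<open>\<psi> (- n)\<close> turns the levels \<open>n\<close> and
      \<open>n + 1\<close> into the two copies of G in P(G,S).\<close>
    have "d (\<psi> n (\<psi> (- n) g), n) = d (\<psi> n (\<psi> (- n) h), n + 1)"
    proof (rule cayley_connectedD[OF conn, of "\<lambda>g. d (\<psi> n g, n)" "\<lambda>h. d (\<psi> n h, n + 1)"])
      fix a b assume "a \<in> carrier G" "b \<in> carrier G" "inv a \<otimes> b \<in> S"
      then show "d (\<psi> n a, n) = d (\<psi> n b, n + 1)"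
        by (intro d_step) (simp add: steps_def)
    qed (use that in simp_all)
    then show ?thesis using that by simp
  qed
  have d_up: "d (\<one>, n) = d (\<one>, n + 1)" for n using d_pair by simp
  have d_one: "d (\<one>, n) = d (\<one>, 0)" for n
  proof (induction n rule: int_induct[where k = 0])
    case (step1 i)
    then show ?case using d_up[of i] by simp
  next
    case (step2 i)
    then show ?case using d_up[of "i - 1"] by simp
  qed simp
  have "snd (f (g, n)) = n + d (\<one>, 0)" if "g \<in> carrier G" for g n
    using d_pair[OF that one_closed, of n] d_one[of "n + 1"] by (simp add: d_def[of "(g, n)"])
  then show thesis by (rule that)
qed

text \<open>After the common shift \<open>j\<close>, rigidity yields a translating element for every
  pair of consecutive levels. Neighbouring pairs share a level, so these elements all agree.\<close>

lemma steps_automorphism_is_translation: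
  assumes rigid: "cayley_rigid G S" and conn: "cayley_connected G S"
    and f: "bij_betw f (carrier H) (carrier H)"
    and edge: "\<And>x y. x \<in> carrier H \<Longrightarrow> y \<in> carrier H \<Longrightarrow>
                 (f x, f y) \<in> steps S \<longleftrightarrow> (x, y) \<in> steps S"
  shows "\<exists>k\<in>carrier H. \<forall>x\<in>carrier H. f x = k \<otimes>\<^bsub>H\<^esub> x"
proof -
  have "(f x, f y) \<in> steps S" if "(x, y) \<in> steps S" for x y
    using that edge[of x y] by (auto simp: steps_def carrier_H)
  then obtain j where j: "\<And>g n. g \<in> carrier G \<Longrightarrow> snd (f (g, n)) = n + j"
    using steps_automorphism_shift[OF conn] by metis
  define F where "F n g = fst (f (g, n))" for n g
  have f_eq: "f (g, n) = (F n g, n + j)" if "g \<in> carrier G" for g n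
    using j[OF that] by (simp add: F_def prod_eq_iff)
  have F_closed [simp]: "F n g \<in> carrier G" if "g \<in> carrier G" for g n
    using bij_betwE[OF f, THEN bspec, of "(g, n)"] that by (auto simp: carrier_H F_def)
  have F_bij: "bij_betw (F n) (carrier G) (carrier G)" for n
  proof (rule bij_betw_imageI)
    show "inj_on (F n) (carrier G)"
    proof (rule inj_onI)
      fix g h assume gh: "g \<in> carrier G" "h \<in> carrier G" "F n g = F n h"
      then have "f (g, n) = f (h, n)" using f_eq by simp
      then show "g = h" using f gh by (auto simp: bij_betw_def inj_on_def carrier_H)
    qed
    have "h \<in> F n ` carrier G" if h: "h \<in> carrier G" for h
    proof -
      have "(h, n + j) \<in> f ` carrier H" using f h by (simp add: bij_betw_def carrier_H)
      then obtain g m where gm: "g \<in> carrier G" "f (g, m) = (h, n + j)"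
        by (force simp: carrier_H)
      then have "m = n" "F n g = h" using f_eq by auto
      then show ?thesis using gm by blast
    qed
    then show "F n ` carrier G = carrier G" by auto
  qed
  have ex: "\<exists>c\<in>carrier G. \<forall>g\<in>carrier G. F n g = c \<otimes> \<psi> j g \<and> F (n + 1) g = c \<otimes> \<psi> j g" for n
  proof -
    \<comment> \<open>These are the actions of \<open>f\<close> on levels \<open>n\<close> and
      \<open>n + 1\<close> in the coordinates of P(G,S). Both use the exponents \<open>n\<close> and
      \<open>n + j\<close> of the lower levels, since \<open>steps\<close> twists both ends of an
      edge by its lower level.\<close>
    let ?a = "\<psi> (- (n + j)) \<circ> F n \<circ> \<psi> n" and ?b = "\<psi> (- (n + j)) \<circ> F (n + 1) \<circ> \<psi> n"
    have a: "bij_betw ?a (carrier G) (carrier G)" and b: "bij_betw ?b (carrier G) (carrier G)"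
      by (blast intro: bij_betw_trans act_bij F_bij)+
    have "inv (?a g) \<otimes> ?b h \<in> S \<longleftrightarrow> inv g \<otimes> h \<in> S" if "g \<in> carrier G" "h \<in> carrier G" for g h
    proof -
      have "(f (\<psi> n g, n), f (\<psi> n h, n + 1)) \<in> steps S \<longleftrightarrow>
          ((\<psi> n g, n), (\<psi> n h, n + 1)) \<in> steps S"
        using that by (intro edge) (simp_all add: carrier_H)
      then show ?thesis using that by (simp add: f_eq steps_def)
    qed
    from cayley_rigidD[OF rigid a b this] obtain k where k: "k \<in> carrier G"
      "\<And>g. g \<in> carrier G \<Longrightarrow> ?a g = k \<otimes> g" "\<And>g. g \<in> carrier G \<Longrightarrow> ?b g = k \<otimes> g"
      by metis
    \<comment> \<open>Going back to the original coordinates turns \<open>k\<close> into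
      \<open>\<psi> (n + j) k\<close> and leaves the twist \<open>\<psi> j\<close> on the
      argument.\<close>
    have translate: "x = \<psi> (n + j) k \<otimes> \<psi> j g"
      if "g \<in> carrier G" "x \<in> carrier G" "\<psi> (- (n + j)) x = k \<otimes> \<psi> (- n) g" for g x
    proof -
      have "x = \<psi> (n + j) (k \<otimes> \<psi> (- n) g)"
        using that(2) that(3)[symmetric] by (simp only: act_cancel)
      also have "\<dots> = \<psi> (n + j) k \<otimes> \<psi> ((n + j) + - n) g"
        using that k by (simp only: act_mult act_add act_closed)
      finally show ?thesis by simp
    qed
    have "F n g = \<psi> (n + j) k \<otimes> \<psi> j g \<and> F (n + 1) g = \<psi> (n + j) k \<otimes> \<psi> j g"
      if "g \<in> carrier G" for g
      using k(2,3)[of "\<psi> (- n) g"] that by (auto intro!: translate simp del: minus_add_distrib)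
    then show ?thesis using k(1) by (intro bexI[of _ "\<psi> (n + j) k"]) simp_all
  qed
  then obtain c where c: "\<And>n. c n \<in> carrier G"
    "\<And>n g. g \<in> carrier G \<Longrightarrow> F n g = c n \<otimes> \<psi> j g"
    "\<And>n g. g \<in> carrier G \<Longrightarrow> F (n + 1) g = c n \<otimes> \<psi> j g"
    by metis
  \<comment> \<open>Level \<open>n + 1\<close> is the upper level of pair \<open>n\<close> and the
    lower level of pair \<open>n + 1\<close>; comparing the two formulas at \<open>\<one>\<close>
    suffices.\<close>
  have c_up: "c (n + 1) = c n" for n
    using c(2)[OF one_closed, of "n + 1"] c(3)[OF one_closed, of n] c(1) by simp
  have c_const: "c n = c 0" for n
  proof (induction n rule: int_induct[where k = 0])
    case (step1 i)
    then show ?case using c_up[of i] by simp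
  next
    case (step2 i)
    then show ?case using c_up[of "i - 1"] by simp
  qed simp
  have "f x = (c 0, j) \<otimes>\<^bsub>H\<^esub> x" if x: "x \<in> carrier H" for x
  proof -
    obtain g n where gn: "x = (g, n)" "g \<in> carrier G" using x by (auto simp: carrier_H)
    show ?thesis using gn c(2)[OF gn(2), of n] c_const[of n] by (simp add: f_eq mult_H)
  qed
  then show ?thesis using c(1) by (intro bexI[of _ "(c 0, j)"]) (simp_all add: carrier_H)
qed

text \<open>Invariance of the order and the description of its automorphisms both pass to
  \<open>steps S\<close> through \<open>order_automorphism_iff\<close>.\<close>

lemma semidirect_product_admits_regular:
  assumes rigid: "cayley_rigid G S" and conn: "cayley_connected G S"
  shows "admits_regular_poset_representation H"
proof -
  interpret H: group H
    using group_semidirect_product[OF is_group group_integer_group action] .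
  interpret graded_relation "carrier H" "steps S" snd by (rule graded_steps)
  show ?thesis
  proof (rule H.admits_regularI[OF partial_order])
    fix k x y assume k: "k \<in> carrier H" and xy: "x \<in> carrier H" "y \<in> carrier H"
    have "bij_betw (\<lambda>x. k \<otimes>\<^bsub>H\<^esub> x) (carrier H) (carrier H)"
      using H.surj_const_mult[OF k] H.inj_on_cmult[OF k] by (simp add: bij_betw_def)
    from order_automorphism_iff[OF this] steps_mult_iff[OF k]
    show "(k \<otimes>\<^bsub>H\<^esub> x, k \<otimes>\<^bsub>H\<^esub> y) \<in> generated_order \<longleftrightarrow> (x, y) \<in> generated_order"
      using xy by blast
  next
    fix f assume f: "bij_betw f (carrier H) (carrier H)"
      and "\<And>x y. x \<in> carrier H \<Longrightarrow> y \<in> carrier H \<Longrightarrow>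
        (f x, f y) \<in> generated_order \<longleftrightarrow> (x, y) \<in> generated_order"
    then have "(f x, f y) \<in> steps S \<longleftrightarrow> (x, y) \<in> steps S"
      if "x \<in> carrier H" "y \<in> carrier H" for x y
      using order_automorphism_iff[OF f] that by blast
    then show "\<exists>k\<in>carrier H. \<forall>x\<in>carrier H. f x = k \<otimes>\<^bsub>H\<^esub> x"
      using steps_automorphism_is_translation[OF rigid conn f] by blast
  qed
qed

end

theorem theorem22:
  fixes G :: "('a, 'b) monoid_scheme" and \<psi> :: "int \<Rightarrow> 'a \<Rightarrow> 'a"
  assumes "group G"
    and "\<not> G \<cong> integer_mod_group 2"
    and "admits_cayley_representation G"
    and "\<psi> \<in> hom integer_group (AutoGroup G)"
  shows "admits_regular_poset_representation (semidirect_product G integer_group \<psi>)"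
proof -
  interpret int_action G \<psi>
    using assms(1,4) by (simp add: int_action_def int_action_axioms_def)
  obtain S where "cayley_rigid G S" "cayley_connected G S"
    using admits_imp_connected_rigid[OF assms(3,2)] .
  then show ?thesis by (rule semidirect_product_admits_regular)
qed

end
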